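(* Let $M>1$, $\mathcal R=[1/M,M]$, $\hat{\boldsymbol x}\in\mathcal R^2\times\mathbb R$ and $\delta>0$. For a positive integer $N$ let $\hat K^{sc,sft}_{\psi,N}$ be the set of $\boldsymbol x\in\mathcal R^2\times\mathbb R$ for which there exist $r_1,\dots,r_N\in\mathbb R$ with $$r_k\ge0\ \ \forall k\in[N-1],\quad \big(2\sqrt{\exp(\hat x_3/\hat x_2)}\,r_1,\,x_1-x_2,\,x_1+x_2\big)\in\mathcal L_3,$$ $$(2r_{k+1},r_k-x_2,r_k+x_2)\in\mathcal L_3\ \ \forall k\in[N-1],\quad r_N=x_2+2^{-N}\big(x_3-x_2(\hat x_3/\hat x_2)\big),$$ equivalently, the set of $\boldsymbol x\in\mathcal R^2\times\mathbb R$ with $$x_1/x_2\ge\exp(\hat x_3/\hat x_2)\,\big(1+2^{-N}(x_3/x_2-\hat x_3/\hat x_2)\big)^{2^N}.$$ For every $\epsilon\in(0,\delta]$ one can choose $N=O(\log(\delta^2/\epsilon))$ such that, restricted to $\boldsymbol x$ with $|x_3/x_2-\hat x_3/\hat x_2|\le\delta$, $$K_{\exp}(0)\subseteq\hat K^{sc,sft}_{\psi,N}\subseteq K_{\exp}(\epsilon).$$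
   Context: $[n]=\{1,\dots,n\}$ (empty for $n=0$); $\mathcal L_3=\{y\in\mathbb R^3:y_3\ge\sqrt{y_1^2+y_2^2}\}$. For $\alpha\in\mathbb R$, $K_{\exp}(\alpha)=\{\boldsymbol x\in\mathcal R^2\times\mathbb R:\ x_1/x_2\ge\exp(x_3/x_2-\alpha)\}$. "Restricted to" means intersecting each set in the chain of inclusions with the indicated set of $\boldsymbol x$. $O(\cdot)$ is the usual asymptotic notation, describing growth in $\delta^2/\epsilon$. *)

theory Defs
  imports "HOL-Analysis.Analysis" "HOL-Library.Landau_Symbols"
begin

definition lorentz3 :: "(real^3) set" where
  "lorentz3 = {y. y$3 \<ge> sqrt ((y$1)\<^sup>2 + (y$2)\<^sup>2)}"

definition ground :: "real \<Rightarrow> (real^3) set" where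
  "ground M = {x. x$1 \<in> {1/M..M} \<and> x$2 \<in> {1/M..M}}"

definition K_exp :: "real \<Rightarrow> real \<Rightarrow> (real^3) set" where
  "K_exp M \<alpha> = {x \<in> ground M. x$1 / x$2 \<ge> exp (x$3 / x$2 - \<alpha>)}"

text \<open>Only the values of \<open>r\<close> at \<open>1, \<dots>, N\<close> are constrained, so \<open>r\<close> encodes
  the tuple \<open>(r\<^sub>1, \<dots>, r\<^sub>N)\<close>.\<close>

definition K_soft :: "real \<Rightarrow> real^3 \<Rightarrow> nat \<Rightarrow> (real^3) set" where
  "K_soft M xh N = {x \<in> ground M. \<exists>r :: nat \<Rightarrow> real.
      (\<forall>k \<in> {1..N-1}. r k \<ge> 0) \<and>
      vector [2 * sqrt (exp (xh$3 / xh$2)) * r 1, x$1 - x$2, x$1 + x$2] \<in> lorentz3 \<and>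
      (\<forall>k \<in> {1..N-1}. vector [2 * r (k+1), r k - x$2, r k + x$2] \<in> lorentz3) \<and>
      r N = x$2 + (x$3 - x$2 * (xh$3 / xh$2)) / 2^N}"

definition near :: "real^3 \<Rightarrow> real \<Rightarrow> (real^3) set" where
  "near xh \<delta> = {x. \<bar>x$3 / x$2 - xh$3 / xh$2\<bar> \<le> \<delta>}"

definition admissible :: "(real \<times> (real^3) \<times> real \<times> real) set" where
  "admissible = {(M, xh, \<delta>, \<epsilon>). M > 1 \<and> xh \<in> ground M \<and> \<delta> > 0 \<and> 0 < \<epsilon> \<and> \<epsilon> \<le> \<delta>}"

text \<open>The limit \<open>\<delta>\<^sup>2 / \<epsilon> \<rightarrow> \<infinity>\<close>, uniformly over all admissible parameters: a property
  holds eventually iff for some \<open>T\<close> it holds at every admissible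
  \<open>(M, xh, \<delta>, \<epsilon>)\<close> with \<open>\<delta>\<^sup>2 / \<epsilon> \<ge> T\<close>.\<close>

definition ratio_at_top :: "(real \<times> (real^3) \<times> real \<times> real) filter" where
  "ratio_at_top =
     inf (filtercomap (\<lambda>(M, xh, \<delta>, \<epsilon>). \<delta>\<^sup>2 / \<epsilon>) at_top) (principal admissible)"

lemma eventually_ratio_at_top:
  "eventually P ratio_at_top \<longleftrightarrow>
    (\<exists>T. \<forall>M xh \<delta> \<epsilon>. (M, xh, \<delta>, \<epsilon>) \<in> admissible \<longrightarrow> \<delta>\<^sup>2 / \<epsilon> \<ge> T \<longrightarrow> P (M, xh, \<delta>, \<epsilon>))"
  unfolding ratio_at_top_def eventually_inf_principal eventually_filtercomap_at_top_linorder
  by (auto; metis)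

end

theory Submission
  imports Defs
begin

text \<open>
  For \<open>b + c \<ge> 0\<close> the cone condition \<open>(2a, b - c, b + c) \<in> lorentz3\<close> says \<open>a\<^sup>2 \<le> bc\<close>, so the chain
  of cone constraints squares \<open>r\<^sub>N / x\<^sub>2 = 1 + t / 2\<^sup>N\<close> with \<open>t = x\<^sub>3/x\<^sub>2 - xh\<^sub>3/xh\<^sub>2\<close> exactly \<open>N\<close> times.
  With \<open>m = 2\<^sup>N\<close>, the upper bound \<open>(1 + t/m)\<^sup>m \<le> exp t\<close> gives the first inclusion, and
  \<open>ln (1 + u) \<ge> u - 2u\<^sup>2\<close> for \<open>\<bar>u\<bar> \<le> 1/2\<close> gives \<open>(1 + t/m)\<^sup>m \<ge> exp (t - 2t\<^sup>2/m)\<close>, hence the second one as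
  soon as \<open>m \<ge> 2\<delta>\<^sup>2/\<epsilon>\<close>. Because \<open>\<epsilon> \<le> \<delta>\<close>, this choice also ensures \<open>m \<ge> 2\<delta>\<close>, that is, \<open>\<bar>t/m\<bar> \<le> 1/2\<close>.
\<close>

text \<open>The difference of \<open>(b + c)^2\<close> and \<open>(b - c)^2\<close> is
  \<open>4 * b * c\<close>. Squaring the cone inequality loses the sign of its right side, which the
  conjunct \<open>0 \<le> b + c\<close> retains.\<close>

lemma lorentz3_rotated_iff:
  fixes a b c :: real
  shows "vector [2 * a, b - c, b + c] \<in> lorentz3 \<longleftrightarrow> a\<^sup>2 \<le> b * c \<and> 0 \<le> b + c"
proof -
  have "(2 * a)\<^sup>2 + (b - c)\<^sup>2 \<le> (b + c)\<^sup>2 \<longleftrightarrow> a\<^sup>2 \<le> b * c"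
    by (simp add: power2_eq_square algebra_simps)
  moreover have "sqrt ((2 * a)\<^sup>2 + (b - c)\<^sup>2) \<le> b + c \<longleftrightarrow>
      (2 * a)\<^sup>2 + (b - c)\<^sup>2 \<le> (b + c)\<^sup>2 \<and> 0 \<le> b + c"
    using real_sqrt_ge_zero[of "(2 * a)\<^sup>2 + (b - c)\<^sup>2"]
    by (auto intro: real_le_lsqrt sqrt_le_D simp del: real_sqrt_ge_0_iff)
  ultimately show ?thesis
    by (simp add: lorentz3_def)
qed

lemma repeated_squaring_le:
  fixes r :: "nat \<Rightarrow> real"
  assumes "\<And>k. k \<in> {1..N-1} \<Longrightarrow> (r (k+1))\<^sup>2 \<le> r k" and "N > 0"
  shows "r N ^ 2 ^ N \<le> (r 1)\<^sup>2"
proof -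
  \<comment> \<open>The index \<open>j\<close> counts steps down from \<open>N\<close>. Keeping a
    square on the right makes the exponent on the left even, so the left side is nonnegative and the
    inequality can be squared again.\<close>
  have "r N ^ 2 ^ (j + 1) \<le> (r (N - j))\<^sup>2" if "j < N" for j
    using that
  proof (induction j)
    case (Suc j)
    have "r N ^ 2 ^ (j + 1) \<le> (r (N - j))\<^sup>2"
      using Suc by simp
    also have "\<dots> \<le> r (N - Suc j)"
    proof -
      have "N - Suc j \<in> {1..N-1}" and "N - Suc j + 1 = N - j"
        using Suc.prems by auto
      then show ?thesis
        using assms(1) by metis
    qed
    finally have "(r N ^ 2 ^ (j + 1))\<^sup>2 \<le> (r (N - Suc j))\<^sup>2"
      by (rule power_mono) simp
    then show ?case
      by (simp add: power_mult [symmetric] mult.commute)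
  qed simp
  from this[of "N - 1"] show ?thesis
    using \<open>N > 0\<close> by simp
qed

text \<open>This eliminates the auxiliary variables. Dividing every \<open>r k\<close> by
  \<open>y\<close> turns the constraints into pure squarings; conversely, a chain of equalities
  serves as witness.\<close>

lemma square_chain_iff:
  fixes b c y s :: real
  assumes "y > 0" and "c > 0" and "N > 0"
  shows "(\<exists>r :: nat \<Rightarrow> real. (\<forall>k \<in> {1..N-1}. r k \<ge> 0) \<and> c * (r 1)\<^sup>2 \<le> b * y \<and>
            (\<forall>k \<in> {1..N-1}. (r (k+1))\<^sup>2 \<le> r k * y) \<and> r N = y * s)
         \<longleftrightarrow> c * s ^ 2 ^ N \<le> b / y"
    (is "?L \<longleftrightarrow> ?R")
proof
  assume ?L
  then obtain r where r1: "c * (r 1)\<^sup>2 \<le> b * y" and rN: "r N = y * s"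
    and rk: "\<And>k. k \<in> {1..N-1} \<Longrightarrow> (r (k+1))\<^sup>2 \<le> r k * y"
    by blast
  have "(r (k+1) / y)\<^sup>2 \<le> r k / y" if "k \<in> {1..N-1}" for k
    using rk[OF that] \<open>y > 0\<close> by (simp add: field_simps power2_eq_square)
  then have "(r N / y) ^ 2 ^ N \<le> (r 1 / y)\<^sup>2"
    using repeated_squaring_le[of N "\<lambda>k. r k / y"] \<open>N > 0\<close> by blast
  then have "c * s ^ 2 ^ N \<le> c * (r 1 / y)\<^sup>2"
    using rN \<open>y > 0\<close> \<open>c > 0\<close> by simp
  also have "\<dots> \<le> b / y"
    using r1 \<open>y > 0\<close> by (simp add: field_simps power2_eq_square)
  finally show ?R .
next
  assume R: ?R
  have sq: "(s ^ 2 ^ j)\<^sup>2 = s ^ 2 ^ Suc j" for j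
    by (simp add: power_mult [symmetric] mult.commute)
  \<comment> \<open>This choice makes each inequality between neighbours tight, and at
    \<open>k = N\<close> the exponent is \<open>2 ^ 0 = 1\<close>, giving
    \<open>y * s\<close>.\<close>
  define r where "r k = y * s ^ 2 ^ (N - k)" for k
  have "r k \<ge> 0" if "k \<in> {1..N-1}" for k
  proof -
    \<comment> \<open>Since \<open>k < N\<close>, the exponent \<open>2 ^ (N - k)\<close> is even,
      so the power is a square even if \<open>s\<close> is negative.\<close>
    have "N - k = Suc (N - k - 1)"
      using that by auto
    then have "s ^ 2 ^ (N - k) \<ge> 0"
      by (metis sq zero_le_power2)
    then show ?thesis
      using \<open>y > 0\<close> by (simp add: r_def)
  qed
  moreover have "(r (k+1))\<^sup>2 = r k * y" if "k \<in> {1..N-1}" for k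
  proof -
    have "Suc (N - (k+1)) = N - k"
      using that by auto
    then show ?thesis
      by (simp only: r_def power_mult_distrib sq) (simp add: power2_eq_square)
  qed
  moreover have "c * (r 1)\<^sup>2 \<le> b * y"
  proof -
    have "Suc (N - 1) = N"
      using \<open>N > 0\<close> by simp
    then have "c * (r 1)\<^sup>2 = (c * s ^ 2 ^ N) * y\<^sup>2"
      by (simp only: r_def power_mult_distrib sq) simp
    also have "\<dots> \<le> b / y * y\<^sup>2"
      using R by (rule mult_right_mono) simp
    finally show ?thesis
      using \<open>y > 0\<close> by (simp add: power2_eq_square)
  qed
  ultimately show ?L
    by (intro exI[of _ r]) (simp add: r_def)
qed

lemma ground_pos:
  assumes "x \<in> ground M" and "M > 1"
  shows "x$1 > 0" and "x$2 > 0"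
proof -
  have "1 / M > 0"
    using \<open>M > 1\<close> by simp
  moreover have "1 / M \<le> x$1" and "1 / M \<le> x$2"
    using assms(1) by (auto simp: ground_def)
  ultimately show "x$1 > 0" and "x$2 > 0"
    by linarith+
qed

lemma K_soft_eq:
  assumes "M > 1" and "N > 0"
  shows "K_soft M xh N = {x \<in> ground M.
           x$1 / x$2 \<ge> exp (xh$3 / xh$2) * (1 + (x$3 / x$2 - xh$3 / xh$2) / 2^N) ^ (2^N)}"
proof -
  have "(\<exists>r :: nat \<Rightarrow> real. (\<forall>k \<in> {1..N-1}. r k \<ge> 0) \<and>
      vector [2 * sqrt (exp (xh$3 / xh$2)) * r 1, x$1 - x$2, x$1 + x$2] \<in> lorentz3 \<and>
      (\<forall>k \<in> {1..N-1}. vector [2 * r (k+1), r k - x$2, r k + x$2] \<in> lorentz3) \<and>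
      r N = x$2 + (x$3 - x$2 * (xh$3 / xh$2)) / 2^N) \<longleftrightarrow>
     exp (xh$3 / xh$2) * (1 + (x$3 / x$2 - xh$3 / xh$2) / 2^N) ^ (2^N) \<le> x$1 / x$2"
    (is "(\<exists>r. ?P r) \<longleftrightarrow> ?R") if "x \<in> ground M" for x :: "real^3"
  proof -
    let ?c = "exp (xh$3 / xh$2)" and ?s = "1 + (x$3 / x$2 - xh$3 / xh$2) / 2^N"
    have pos: "x$1 > 0" "x$2 > 0"
      using ground_pos[OF that \<open>M > 1\<close>] by auto
    have first: "vector [2 * sqrt ?c * \<rho>, x$1 - x$2, x$1 + x$2] \<in> lorentz3 \<longleftrightarrow>
        ?c * \<rho>\<^sup>2 \<le> x$1 * x$2" for \<rho>
      using pos lorentz3_rotated_iff[of "sqrt ?c * \<rho>" "x$1" "x$2"]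
      by (simp add: mult.assoc power_mult_distrib)
    have last: "x$2 + (x$3 - x$2 * (xh$3 / xh$2)) / 2^N = x$2 * ?s"
    proof -
      have "x$3 - x$2 * (xh$3 / xh$2) = x$2 * (x$3 / x$2 - xh$3 / xh$2)"
        using pos by (simp add: right_diff_distrib)
      then show ?thesis
        by (simp add: distrib_left)
    qed
    have "?P r \<longleftrightarrow> (\<forall>k \<in> {1..N-1}. r k \<ge> 0) \<and> ?c * (r 1)\<^sup>2 \<le> x$1 * x$2 \<and>
            (\<forall>k \<in> {1..N-1}. (r (k+1))\<^sup>2 \<le> r k * x$2) \<and> r N = x$2 * ?s" for r
      \<comment> \<open>The sign conditions \<open>0 \<le> r k + x$2\<close> left by the cones
        follow from \<open>r k \<ge> 0\<close> and \<open>x$2 > 0\<close>.\<close>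
      unfolding first last lorentz3_rotated_iff using pos by (auto intro: add_nonneg_nonneg)
    then show ?thesis
      using square_chain_iff[of "x$2" ?c N "x$1" ?s] pos \<open>N > 0\<close> by simp
  qed
  then show ?thesis
    unfolding K_soft_def by blast
qed

text \<open>With \<open>u = t / m\<close>, each factor \<open>1 + u\<close> is at least
  \<open>exp (u - 2 * u^2)\<close>; over \<open>m\<close> factors the losses in the exponent add up
  to \<open>2 * t^2 / m\<close>.\<close>

lemma one_plus_over_n_power_ge_exp:
  fixes t :: real
  assumes "m > 0" and "2 * \<bar>t\<bar> \<le> real m"
  shows "exp (t - 2 * t\<^sup>2 / real m) \<le> (1 + t / real m) ^ m"
proof -
  let ?u = "t / real m"
  have u: "\<bar>?u\<bar> \<le> 1 / 2"
    using assms by (simp add: field_simps)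
  then have "1 + ?u > 0"
    by linarith
  have "?u - 2 * ?u\<^sup>2 \<le> ln (1 + ?u)"
    using abs_ln_one_plus_x_minus_x_bound[OF u] by linarith
  then have "exp (?u - 2 * ?u\<^sup>2) \<le> 1 + ?u"
    using \<open>1 + ?u > 0\<close> by (simp add: ln_ge_iff)
  then have "exp (?u - 2 * ?u\<^sup>2) ^ m \<le> (1 + ?u) ^ m"
    by (rule power_mono) simp
  moreover have "real m * (?u - 2 * ?u\<^sup>2) = t - 2 * t\<^sup>2 / real m"
    using \<open>m > 0\<close> by (simp add: field_simps power2_eq_square)
  ultimately show ?thesis
    by (metis exp_of_nat_mult)
qed

lemma K_exp_subset_K_soft:
  assumes "M > 1" and "N > 0" and "\<delta> \<le> 2 ^ N"
  shows "K_exp M 0 \<inter> near xh \<delta> \<subseteq> K_soft M xh N"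
proof
  fix x assume x: "x \<in> K_exp M 0 \<inter> near xh \<delta>"
  let ?t = "x$3 / x$2 - xh$3 / xh$2"
  \<comment> \<open>This keeps the base \<open>1 + ?t / 2^N\<close> nonnegative; for a very negative
    base the even power could exceed \<open>exp ?t\<close>.\<close>
  have "- (2 ^ N) \<le> ?t"
    using x assms by (auto simp: near_def)
  then have "(1 + ?t / 2^N) ^ (2^N) \<le> exp ?t"
    using exp_ge_one_plus_x_over_n_power_n[of "2^N" ?t] by simp
  then have "exp (xh$3 / xh$2) * (1 + ?t / 2^N) ^ (2^N) \<le> exp (xh$3 / xh$2) * exp ?t"
    by simp
  also have "\<dots> = exp (x$3 / x$2)"
    by (simp add: exp_add [symmetric])
  also have "\<dots> \<le> x$1 / x$2"
    using x by (simp add: K_exp_def)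
  finally show "x \<in> K_soft M xh N"
    using x assms by (simp add: K_soft_eq K_exp_def)
qed

text \<open>The two lower bounds on \<open>2 ^ N\<close> have separate tasks:
  \<open>2 * \<delta>\<close> puts \<open>t / 2 ^ N\<close> in the range of the logarithm estimate,
  and \<open>2 * \<delta>^2 / \<epsilon>\<close> keeps the loss in the exponent below
  \<open>\<epsilon>\<close>.\<close>

lemma K_soft_subset_K_exp:
  assumes "M > 1" and "N > 0" and "2 * \<delta> \<le> 2 ^ N" and "0 < \<epsilon>" and "2 * \<delta>\<^sup>2 / \<epsilon> \<le> 2 ^ N"
  shows "K_soft M xh N \<inter> near xh \<delta> \<subseteq> K_exp M \<epsilon>"
proof
  fix x assume x: "x \<in> K_soft M xh N \<inter> near xh \<delta>"
  let ?t = "x$3 / x$2 - xh$3 / xh$2"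
  have t: "\<bar>?t\<bar> \<le> \<delta>"
    using x by (simp add: near_def)
  then have "?t\<^sup>2 \<le> \<delta>\<^sup>2"
    by (metis abs_ge_zero power2_abs power_mono)
  moreover have "2 * \<delta>\<^sup>2 \<le> \<epsilon> * 2 ^ N"
    using assms by (simp add: field_simps)
  ultimately have "2 * ?t\<^sup>2 \<le> \<epsilon> * 2 ^ N"
    by linarith
  then have "2 * ?t\<^sup>2 / 2 ^ N \<le> \<epsilon>"
    by (simp add: divide_le_eq)
  then have "exp (?t - \<epsilon>) \<le> exp (?t - 2 * ?t\<^sup>2 / 2 ^ N)"
    by simp
  also have "\<dots> \<le> (1 + ?t / 2^N) ^ (2^N)"
    using one_plus_over_n_power_ge_exp[of "2^N" ?t] t assms by simp
  finally have "exp (xh$3 / xh$2) * exp (?t - \<epsilon>) \<le> exp (xh$3 / xh$2) * (1 + ?t / 2^N) ^ (2^N)"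
    by simp
  also have "\<dots> \<le> x$1 / x$2"
    using x assms by (simp add: K_soft_eq)
  finally have "exp (x$3 / x$2 - \<epsilon>) \<le> x$1 / x$2"
    by (simp add: exp_add [symmetric])
  then show "x \<in> K_exp M \<epsilon>"
    using x assms by (simp add: K_soft_eq K_exp_def)
qed

definition soft_depth :: "real \<times> (real^3) \<times> real \<times> real \<Rightarrow> nat" where
  \<comment> \<open>The maximum with 1 covers ratios
    \<open>2 * \<delta>^2 / \<epsilon> \<le> 1\<close>, where the logarithm is at most 0.\<close>
  "soft_depth = (\<lambda>(M, xh, \<delta>, \<epsilon>). max 1 (nat \<lceil>log 2 (2 * \<delta>\<^sup>2 / \<epsilon>)\<rceil>))"

lemma le_two_power_soft_depth:
  assumes "\<delta> > 0" and "0 < \<epsilon>"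
  shows "2 * \<delta>\<^sup>2 / \<epsilon> \<le> 2 ^ soft_depth (M, xh, \<delta>, \<epsilon>)"
proof -
  have "2 * \<delta>\<^sup>2 / \<epsilon> > 0"
    using assms by simp
  moreover have "log 2 (2 * \<delta>\<^sup>2 / \<epsilon>) \<le> real (soft_depth (M, xh, \<delta>, \<epsilon>))"
    unfolding soft_depth_def by simp linarith
  ultimately show ?thesis
    by (simp add: log_le_iff powr_realpow)
qed

text \<open>The factor 2 inside the logarithm and the rounding up cost at most 1 each.\<close>

lemma soft_depth_bigo:
  "(\<lambda>p. real (soft_depth p)) \<in> O[ratio_at_top](\<lambda>(M, xh, \<delta>, \<epsilon>). ln (\<delta>\<^sup>2 / \<epsilon>))"
\<comment> \<open>From ratio 2 on, the binary logarithm is at least 1, so the additive 2 is absorbed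
  into a factor 3; dividing by \<open>ln 2\<close> changes the base.\<close>
proof (rule bigoI[where c = "3 / ln 2"], unfold eventually_ratio_at_top,
    intro exI[of _ 2] allI impI)
  fix M :: real and xh :: "real^3" and \<delta> \<epsilon> :: real
  assume ratio: "\<delta>\<^sup>2 / \<epsilon> \<ge> 2"
  let ?R = "\<delta>\<^sup>2 / \<epsilon>"
  have log_ge_1: "log 2 ?R \<ge> 1"
    using ratio by (simp add: le_log_iff)
  have "log 2 (2 * ?R) = 1 + log 2 ?R"
    using ratio by (subst log_mult) auto
  then have "real (soft_depth (M, xh, \<delta>, \<epsilon>)) \<le> 2 + log 2 ?R"
    using log_ge_1 unfolding soft_depth_def by simp linarith
  also have "\<dots> \<le> 3 * log 2 ?R"
    using log_ge_1 by simp
  also have "\<dots> = 3 / ln 2 * ln ?R"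
    by (simp add: log_def)
  finally show "norm (real (soft_depth (M, xh, \<delta>, \<epsilon>)))
      \<le> 3 / ln 2 * norm (case (M, xh, \<delta>, \<epsilon>) of (M, xh, \<delta>, \<epsilon>) \<Rightarrow> ln (\<delta>\<^sup>2 / \<epsilon>))"
    using ratio by simp
qed

theorem theorem5:
  shows "(\<forall>M xh N. M > 1 \<and> xh \<in> ground M \<and> N > 0 \<longrightarrow>
            K_soft M xh N = {x \<in> ground M.
              x$1 / x$2 \<ge> exp (xh$3 / xh$2) * (1 + (x$3 / x$2 - xh$3 / xh$2) / 2^N) ^ (2^N)})
       \<and> (\<exists>N :: real \<times> (real^3) \<times> real \<times> real \<Rightarrow> nat.
            (\<lambda>p. real (N p)) \<in> O[ratio_at_top](\<lambda>(M, xh, \<delta>, \<epsilon>). ln (\<delta>\<^sup>2 / \<epsilon>))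
          \<and> (\<forall>M xh \<delta> \<epsilon>. M > 1 \<and> xh \<in> ground M \<and> \<delta> > 0 \<and> 0 < \<epsilon> \<and> \<epsilon> \<le> \<delta> \<longrightarrow>
               N (M, xh, \<delta>, \<epsilon>) > 0
             \<and> K_exp M 0 \<inter> near xh \<delta> \<subseteq> K_soft M xh (N (M, xh, \<delta>, \<epsilon>)) \<inter> near xh \<delta>
             \<and> K_soft M xh (N (M, xh, \<delta>, \<epsilon>)) \<inter> near xh \<delta> \<subseteq> K_exp M \<epsilon> \<inter> near xh \<delta>))"
proof (intro conjI exI[of _ soft_depth] allI impI)
  fix M :: real and xh :: "real^3" and N :: nat
  assume "M > 1 \<and> xh \<in> ground M \<and> N > 0"
  then show "K_soft M xh N = {x \<in> ground M.
      x$1 / x$2 \<ge> exp (xh$3 / xh$2) * (1 + (x$3 / x$2 - xh$3 / xh$2) / 2^N) ^ (2^N)}"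
    by (simp add: K_soft_eq)
next
  show "(\<lambda>p. real (soft_depth p)) \<in> O[ratio_at_top](\<lambda>(M, xh, \<delta>, \<epsilon>). ln (\<delta>\<^sup>2 / \<epsilon>))"
    by (rule soft_depth_bigo)
next
  fix M :: real and xh :: "real^3" and \<delta> \<epsilon> :: real
  assume A: "M > 1 \<and> xh \<in> ground M \<and> \<delta> > 0 \<and> 0 < \<epsilon> \<and> \<epsilon> \<le> \<delta>"
  let ?N = "soft_depth (M, xh, \<delta>, \<epsilon>)"
  show N: "?N > 0"
    by (simp add: soft_depth_def)
  have ratio: "2 * \<delta>\<^sup>2 / \<epsilon> \<le> 2 ^ ?N"
    using A by (intro le_two_power_soft_depth) auto
  \<comment> \<open>Here \<open>\<epsilon> \<le> \<delta>\<close> enters, as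
    \<open>\<delta> / \<epsilon> \<ge> 1\<close>.\<close>
  have "2 * \<delta> \<le> 2 * \<delta>\<^sup>2 / \<epsilon>"
    using A by (simp add: field_simps power2_eq_square)
  with ratio have delta: "2 * \<delta> \<le> 2 ^ ?N"
    by linarith
  show "K_exp M 0 \<inter> near xh \<delta> \<subseteq> K_soft M xh ?N \<inter> near xh \<delta>"
    using K_exp_subset_K_soft[of M ?N \<delta> xh] A N delta by auto
  show "K_soft M xh ?N \<inter> near xh \<delta> \<subseteq> K_exp M \<epsilon> \<inter> near xh \<delta>"
    using K_soft_subset_K_exp[of M ?N \<delta> \<epsilon> xh] A N delta ratio by auto
qed

end
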